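(* Let $\mathcal F\subseteq\omega^\omega$ and let $\mathcal I,\mathcal J$ be ideals on $\omega$ such that $\mathcal I$ is tall and $\mathcal I\not\le_{\mathcal F}\mathcal J\restriction A$ for all $A\notin\mathcal J$. Then: (1) $\mathfrak p(\mathcal J)\le\mathfrak{fip}(\mathcal I,\mathcal J,\mathcal F)$; (2) $\operatorname{add}^*(\mathcal I)\le\mathfrak{fip}(\mathcal I,\mathcal J,\mathcal F)$.
   Context: An ideal on a set $X$ is a family of subsets of $X$ closed under finite unions and subsets, containing all finite subsets of $X$ and not containing $X$; $\mathcal J^+$ is the family of subsets of $X$ not in $\mathcal J$. $\mathcal I$ on $\omega$ is tall if every infinite $A\subseteq\omega$ contains an infinite $B\in\mathcal I$. For $A\notin\mathcal J$, $\mathcal J\restriction A=\{B\cap A:B\in\mathcal J\}$ (an ideal on $A$), and $\mathcal I\le_{\mathcal F}\mathcal J\restriction A$ means that there is $f\in\mathcal F$ with $f^{-1}[B]\cap A\in\mathcal J$ for every $B\in\mathcal I$ (functions in $\mathcal F$ are restricted to $A$). A nonempty family $\mathcal A\subseteq\mathcal P(\omega)$ has $\mathcal J^+$-FIP if $\bigcap F\in\mathcal J^+$ for each finite $F\subseteq\mathcal A$. A set $B\in\mathcal J^+$ is a $\mathcal J^+$-pseudointersection of $\mathcal A$ if $B\setminus A\in\mathcal J$ for each $A\in\mathcal A$. With $\mathfrak c=2^{\aleph_0}$: $\mathfrak p(\mathcal J)=\min(\{|\mathcal A|:\mathcal A$ has $\mathcal J^+$-FIP but has no $\mathcal J^+$-pseudointersection$\}\cup\{\mathfrak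 c^+\})$; $\operatorname{add}^*(\mathcal I)=\min\{|\mathcal A|:\mathcal A\subseteq\mathcal I$ and there is no $B\in\mathcal I$ with $A\setminus B$ finite for all $A\in\mathcal A\}$ (well defined for tall $\mathcal I$); $\mathfrak{fip}(\mathcal I,\mathcal J,\mathcal F)$ is the minimum of the set consisting of $\mathfrak c^+$ and all cardinals $|\mathcal A|$ such that $\mathcal A\subseteq\mathcal P(\omega)$ has $\mathcal J^+$-FIP and it is not true that for every $f\in\mathcal F$ there is $B\in\mathcal I$ such that $\mathcal A\cup\{f^{-1}[B]\}$ has $\mathcal J^+$-FIP. *)

theory Defs
  imports Main
begin

unbundle cardinal_syntax

definition ideal_on :: "'a set \<Rightarrow> 'a set set \<Rightarrow> bool" where
  "ideal_on X J \<longleftrightarrow>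
     J \<subseteq> Pow X \<and>
     (\<forall>A\<in>J. \<forall>B\<in>J. A \<union> B \<in> J) \<and>
     (\<forall>A\<in>J. \<forall>B. B \<subseteq> A \<longrightarrow> B \<in> J) \<and>
     (\<forall>A. A \<subseteq> X \<longrightarrow> finite A \<longrightarrow> A \<in> J) \<and>
     X \<notin> J"

definition positive :: "nat set set \<Rightarrow> nat set set" where
  "positive J = {A. A \<notin> J}"

definition tall :: "nat set set \<Rightarrow> bool" where
  "tall I \<longleftrightarrow> (\<forall>A. infinite A \<longrightarrow> (\<exists>B\<in>I. infinite B \<and> B \<subseteq> A))"

definition restrict_ideal :: "'a set set \<Rightarrow> 'a set \<Rightarrow> 'a set set" where
  "restrict_ideal J A = {B \<inter> A | B. B \<in> J}"

text \<open>
  \<open>le_restrict F I J A\<close> renders \<open>I \<le>\<^sub>F J \<restriction> A\<close>. Membership is tested in \<open>J\<close>; the lemma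
  \<open>le_restrict_iff\<close> shows that testing it in the restricted ideal gives the same relation.
\<close>

definition le_restrict :: "(nat \<Rightarrow> nat) set \<Rightarrow> nat set set \<Rightarrow> nat set set \<Rightarrow> nat set \<Rightarrow> bool" where
  "le_restrict F I J A \<longleftrightarrow> (\<exists>f\<in>F. \<forall>B\<in>I. f -` B \<inter> A \<in> J)"

lemma ideal_onD:
  assumes "ideal_on X J"
  shows "A \<in> J \<Longrightarrow> B \<in> J \<Longrightarrow> A \<union> B \<in> J"
    and "A \<in> J \<Longrightarrow> B \<subseteq> A \<Longrightarrow> B \<in> J"
    and "A \<subseteq> X \<Longrightarrow> finite A \<Longrightarrow> A \<in> J"
    and "X \<notin> J"
  using assms by (simp_all add: ideal_on_def)

lemma in_restrict_ideal_iff: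
  assumes "ideal_on X J"
  shows "S \<in> restrict_ideal J A \<longleftrightarrow> S \<in> J \<and> S \<subseteq> A"
proof
  assume "S \<in> restrict_ideal J A"
  then obtain B where B: "B \<in> J" "S = B \<inter> A" by (auto simp: restrict_ideal_def)
  then show "S \<in> J \<and> S \<subseteq> A" by (simp add: ideal_onD(2)[OF assms B(1)])
next
  assume S: "S \<in> J \<and> S \<subseteq> A"
  then have "S = S \<inter> A" by (simp add: Int_absorb2)
  with S show "S \<in> restrict_ideal J A" by (auto simp: restrict_ideal_def)
qed

lemma ideal_on_restrict:
  assumes "ideal_on X J" "A \<subseteq> X" "A \<notin> J"
  shows "ideal_on A (restrict_ideal J A)"
  unfolding ideal_on_def
proof (intro conjI ballI allI impI)
  note sub = in_restrict_ideal_iff[OF assms(1)] and D = ideal_onD[OF assms(1)]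
  show "restrict_ideal J A \<subseteq> Pow A" by (auto simp: restrict_ideal_def)
  show "S \<union> T \<in> restrict_ideal J A"
    if "S \<in> restrict_ideal J A" "T \<in> restrict_ideal J A" for S T
    using that D(1)[of S T] by (simp add: sub)
  show "T \<in> restrict_ideal J A" if "S \<in> restrict_ideal J A" "T \<subseteq> S" for S T
    using that D(2)[of S T] by (auto simp: sub)
  show "S \<in> restrict_ideal J A" if "S \<subseteq> A" "finite S" for S
    using that assms(2) D(3)[of S] by (auto simp: sub)
  show "A \<notin> restrict_ideal J A" using assms(3) by (simp add: sub)
qed

lemma le_restrict_iff:
  assumes "ideal_on UNIV J"
  shows "le_restrict F I J A \<longleftrightarrow> (\<exists>f\<in>F. \<forall>B\<in>I. f -` B \<inter> A \<in> restrict_ideal J A)"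
  by (simp add: le_restrict_def in_restrict_ideal_iff[OF assms])

definition has_FIP :: "nat set set \<Rightarrow> nat set set \<Rightarrow> bool" where
  "has_FIP J \<A> \<longleftrightarrow> \<A> \<noteq> {} \<and> (\<forall>G. finite G \<longrightarrow> G \<subseteq> \<A> \<longrightarrow> \<Inter>G \<in> positive J)"

definition pseudointersection :: "nat set set \<Rightarrow> nat set set \<Rightarrow> nat set \<Rightarrow> bool" where
  "pseudointersection J \<A> B \<longleftrightarrow> B \<in> positive J \<and> (\<forall>A\<in>\<A>. B - A \<in> J)"

text \<open>
  Cardinals are represented by cardinal orders, compared by \<open>\<le>o\<close> and identified up to \<open>=o\<close>.
  The type \<^typ>\<open>nat set set rel\<close> has room for the cardinality of every family of subsets of
  \<open>\<omega>\<close> and for the successor of the continuum; \<open>cards S\<close> consists of all the representatives in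
  that type of the cardinalities of the members of \<open>S\<close>.
\<close>

type_synonym cardinal = "nat set set rel"

definition cards :: "nat set set set \<Rightarrow> cardinal set" where
  "cards S = {r. Card_order r \<and> (\<exists>\<A>\<in>S. r =o |\<A>| )}"

definition card_min :: "cardinal set \<Rightarrow> cardinal" where
  "card_min R = (SOME r. r \<in> R \<and> (\<forall>r'\<in>R. r \<le>o r'))"

definition continuum_succ :: cardinal where
  "continuum_succ = cardSuc |UNIV :: nat set set|"

definition p_inv :: "nat set set \<Rightarrow> cardinal" where
  "p_inv J = card_min
     (cards {\<A>. has_FIP J \<A> \<and> \<not> (\<exists>B. pseudointersection J \<A> B)} \<union> {continuum_succ})"

definition add_star :: "nat set set \<Rightarrow> cardinal" where
  "add_star I = card_min (cards {\<A>. \<A> \<subseteq> I \<and> \<not> (\<exists>B\<in>I. \<forall>A\<in>\<A>. finite (A - B))})"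

definition fip_inv :: "nat set set \<Rightarrow> nat set set \<Rightarrow> (nat \<Rightarrow> nat) set \<Rightarrow> cardinal" where
  "fip_inv I J F = card_min
     (cards {\<A>. has_FIP J \<A> \<and> \<not> (\<forall>f\<in>F. \<exists>B\<in>I. has_FIP J (\<A> \<union> {f -` B}))} \<union> {continuum_succ})"

lemma Card_order_continuum_succ: "Card_order continuum_succ"
  unfolding continuum_succ_def by (rule cardSuc_Card_order[OF card_of_Card_order])

lemma card_min_attained:
  assumes "R \<noteq> {}" "\<And>r. r \<in> R \<Longrightarrow> Card_order r"
  shows "card_min R \<in> R" "\<And>r. r \<in> R \<Longrightarrow> card_min R \<le>o r"
proof -
  have "\<exists>r. r \<in> R \<and> (\<forall>r'\<in>R. r \<le>o r')"
    using exists_minim_Card_order[of R] assms by blast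
  from someI_ex[OF this] show "card_min R \<in> R" "\<And>r. r \<in> R \<Longrightarrow> card_min R \<le>o r"
    unfolding card_min_def by blast+
qed

lemma cards_represented:
  assumes "\<A> \<in> S"
  shows "\<exists>r\<in>cards S. r =o |\<A>|"
proof -
  have "bij_betw (\<lambda>x. {x}) \<A> ((\<lambda>x. {x}) ` \<A>)" by (auto simp: bij_betw_def)
  then have "|(\<lambda>x. {x}) ` \<A>| =o |\<A>|"
    using card_of_ordIsoI ordIso_symmetric by blast
  moreover have "Card_order |(\<lambda>x. {x}) ` \<A>|" by (rule card_of_Card_order)
  ultimately show ?thesis using assms unfolding cards_def by blast
qed

lemma add_star_well_defined:
  assumes "ideal_on UNIV I" "tall I"
  shows "cards {\<A>. \<A> \<subseteq> I \<and> \<not> (\<exists>B\<in>I. \<forall>A\<in>\<A>. finite (A - B))} \<noteq> {}"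
proof -
  have "\<not> (\<exists>B\<in>I. \<forall>A\<in>I. finite (A - B))"
  proof
    assume "\<exists>B\<in>I. \<forall>A\<in>I. finite (A - B)"
    then obtain B where B: "B \<in> I" "\<And>A. A \<in> I \<Longrightarrow> finite (A - B)" by blast
    have "infinite (- B)"
    proof
      assume "finite (- B)"
      then have "- B \<union> B \<in> I"
        by (intro ideal_onD(1)[OF assms(1)] ideal_onD(3)[OF assms(1)] B(1)) simp_all
      moreover have "- B \<union> B = UNIV" by blast
      ultimately show False using ideal_onD(4)[OF assms(1)] by simp
    qed
    then obtain A where "A \<in> I" "infinite A" "A \<subseteq> - B" using assms(2) unfolding tall_def by blast
    moreover have "A - B = A" using \<open>A \<subseteq> - B\<close> by blast
    ultimately show False using B(2)[of A] by simp
  qed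
  then have "I \<in> {\<A>. \<A> \<subseteq> I \<and> \<not> (\<exists>B\<in>I. \<forall>A\<in>\<A>. finite (A - B))}" by simp
  from cards_represented[OF this] show ?thesis by blast
qed

end

theory Submission
  imports Defs "HOL-Algebra.Free_Abelian_Groups"
begin

text \<open>
  Both inequalities take a family \<open>\<A>\<close> with \<open>J\<^sup>+\<close>-FIP and an \<open>f \<in> F\<close> such that no
  \<open>f\<^sup>-\<^sup>1[B]\<close> with \<open>B \<in> I\<close> can be added to \<open>\<A>\<close>, and show that the other invariant is at
  most \<open>|\<A>|\<close>; if there is no such family, \<open>fip(I, J, F)\<close> is \<open>c\<^sup>+\<close>, which bounds both invariants.

  For \<open>p(J)\<close>, such an \<open>\<A>\<close> has no \<open>J\<^sup>+\<close>-pseudointersection: if \<open>C\<close> were one, the failure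
  of \<open>I \<le> J \<restriction> C\<close> would give \<open>B \<in> I\<close> with \<open>f\<^sup>-\<^sup>1[B] \<inter> C\<close> positive, and this set is
  contained modulo \<open>J\<close> in every finite intersection from \<open>\<A>\<close>.

  For \<open>add\<^sup>*(I)\<close>, a set \<open>b G \<in> I\<close> is attached to every finite \<open>G \<subseteq> \<A>\<close> so that no single
  \<open>B \<in> I\<close> almost contains all of them (lemma \<open>unbounded_family_of_finite_subsets\<close>). Taking
  \<open>b G\<close> to be any set with \<open>f\<^sup>-\<^sup>1[b G] \<inter> \<Inter>G\<close> positive is not enough, because
  \<open>f\<close> need not be finite-to-one: the finite set \<open>b G - B\<close> may have a positive preimage. The
  points responsible for this are those of \<open>N G = {n. f\<^sup>-\<^sup>1{n} \<inter> \<Inter>G \<notin> J}\<close>, a set decreasing in \<open>G\<close>.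
  If \<open>N G\<^sub>0\<close> is empty for some \<open>G\<^sub>0\<close>, finite errors become negligible on \<open>\<Inter>G\<^sub>0\<close>, and
  the naive choice made for \<open>G \<union> G\<^sub>0\<close> works. Otherwise no \<open>N G\<close> is finite, since a
  finite one would itself be a \<open>B \<in> I\<close> whose preimage can be added; so, by tallness, \<open>b G\<close> can be
  an infinite subset of \<open>N G\<close>, and a set that almost contains it meets \<open>N G\<close>. Finally, \<open>\<A>\<close>
  is infinite, and hence has only \<open>|\<A>|\<close> many finite subsets.
\<close>

section \<open>Positive finite intersections\<close>

lemma has_FIP_insert_iff:
  assumes "ideal_on UNIV J"
  shows "has_FIP J (insert X \<A>) \<longleftrightarrow> (\<forall>G\<in>Fpow \<A>. X \<inter> \<Inter>G \<notin> J)"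
proof
  assume fip: "has_FIP J (insert X \<A>)"
  show "\<forall>G\<in>Fpow \<A>. X \<inter> \<Inter>G \<notin> J"
  proof
    fix G assume "G \<in> Fpow \<A>"
    then have "finite (insert X G)" "insert X G \<subseteq> insert X \<A>" by (auto simp: Fpow_def)
    then have "\<Inter>(insert X G) \<in> positive J" using fip unfolding has_FIP_def by blast
    then show "X \<inter> \<Inter>G \<notin> J" by (simp add: Defs.positive_def)
  qed
next
  assume pos: "\<forall>G\<in>Fpow \<A>. X \<inter> \<Inter>G \<notin> J"
  have "\<Inter>G \<notin> J" if "finite G" "G \<subseteq> insert X \<A>" for G
  proof
    assume "\<Inter>G \<in> J"
    moreover have "X \<inter> \<Inter>(G - {X}) \<subseteq> \<Inter>G" by blast
    ultimately have "X \<inter> \<Inter>(G - {X}) \<in> J" using ideal_onD(2)[OF assms] by blast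
    moreover have "G - {X} \<in> Fpow \<A>" using that by (auto simp: Fpow_def)
    ultimately show False using pos by blast
  qed
  then show "has_FIP J (insert X \<A>)" by (simp add: has_FIP_def Defs.positive_def)
qed

lemma has_FIP_Inter_notin:
  assumes "has_FIP J \<A>" "G \<in> Fpow \<A>"
  shows "\<Inter>G \<notin> J"
  using assms unfolding has_FIP_def Fpow_def Defs.positive_def by blast

lemma not_le_restrictE:
  assumes "\<not> le_restrict F I J A" "f \<in> F"
  obtains B where "B \<in> I" "f -` B \<inter> A \<notin> J"
  using assms unfolding le_restrict_def by blast

lemma ideal_on_UN:
  assumes "ideal_on X J" "finite K" "\<And>k. k \<in> K \<Longrightarrow> S k \<in> J"
  shows "(\<Union>k\<in>K. S k) \<in> J"
  using assms(2,3)
proof (induction K)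
  case empty
  then show ?case using ideal_onD(3)[OF assms(1), of "{}"] by simp
next
  case (insert k K)
  then show ?case using ideal_onD(1)[OF assms(1), of "S k" "\<Union>k\<in>K. S k"] by simp
qed

lemma vimage_finite_Int_in_ideal:
  assumes "ideal_on X J" "finite K" "\<And>n. n \<in> K \<Longrightarrow> f -` {n} \<inter> C \<in> J"
  shows "f -` K \<inter> C \<in> J"
proof -
  have "f -` K \<inter> C = (\<Union>n\<in>K. f -` {n} \<inter> C)" by blast
  then show ?thesis using ideal_on_UN[OF assms(1,2), of "\<lambda>n. f -` {n} \<inter> C"] assms(3) by simp
qed

section \<open>Pseudointersections\<close>

lemma pseudointersection_Diff_Inter_in_ideal:
  assumes "ideal_on UNIV J" "pseudointersection J \<A> C" "G \<in> Fpow \<A>"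
  shows "C - \<Inter>G \<in> J"
proof -
  have "C - \<Inter>G = (\<Union>A\<in>G. C - A)" by blast
  moreover have "(\<Union>A\<in>G. C - A) \<in> J"
    by (rule ideal_on_UN[OF assms(1)]) (use assms in \<open>auto simp: Fpow_def pseudointersection_def\<close>)
  ultimately show ?thesis by simp
qed

lemma vimage_extends_FIP_if_pseudointersection:
  assumes J: "ideal_on UNIV J"
    and not_le: "\<And>A. A \<notin> J \<Longrightarrow> \<not> le_restrict F I J A"
    and C: "pseudointersection J \<A> C"
    and "f \<in> F"
  shows "\<exists>B\<in>I. has_FIP J (\<A> \<union> {f -` B})"
proof -
  have "C \<notin> J" using C by (simp add: pseudointersection_def Defs.positive_def)
  then obtain B where B: "B \<in> I" "f -` B \<inter> C \<notin> J"
    using not_le_restrictE[OF not_le \<open>f \<in> F\<close>] by blast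
  have "f -` B \<inter> \<Inter>G \<notin> J" if G: "G \<in> Fpow \<A>" for G
  proof
    assume "f -` B \<inter> \<Inter>G \<in> J"
    then have "(f -` B \<inter> \<Inter>G) \<union> (C - \<Inter>G) \<in> J"
      by (rule ideal_onD(1)[OF J _ pseudointersection_Diff_Inter_in_ideal[OF J C G]])
    moreover have "f -` B \<inter> C \<subseteq> (f -` B \<inter> \<Inter>G) \<union> (C - \<Inter>G)" by blast
    ultimately show False using B(2) ideal_onD(2)[OF J] by blast
  qed
  with B(1) show ?thesis by (auto simp: has_FIP_insert_iff[OF J])
qed

section \<open>Unbounded families in a tall ideal\<close>

lemma unbounded_family_of_finite_subsets:
  assumes I: "ideal_on UNIV I" and J: "ideal_on UNIV J" and "tall I"
    and not_le: "\<And>A. A \<notin> J \<Longrightarrow> \<not> le_restrict F I J A"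
    and fip: "has_FIP J \<A>" and "f \<in> F"
    and no_ext: "\<not> (\<exists>B\<in>I. has_FIP J (\<A> \<union> {f -` B}))"
  obtains b where "b ` Fpow \<A> \<subseteq> I" "\<not> (\<exists>B\<in>I. \<forall>G\<in>Fpow \<A>. finite (b G - B))"
proof -
  define N where "N G = {n. f -` {n} \<inter> \<Inter>G \<notin> J}" for G
  have no_B: "\<exists>G\<in>Fpow \<A>. f -` B \<inter> \<Inter>G \<in> J" if "B \<in> I" for B
    using no_ext that by (simp add: has_FIP_insert_iff[OF J])
  have Fpow_Un: "G \<union> H \<in> Fpow \<A>" if "G \<in> Fpow \<A>" "H \<in> Fpow \<A>" for G H
    using that by (simp add: Fpow_def)
  show ?thesis
  proof (cases "\<exists>G0\<in>Fpow \<A>. N G0 = {}")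
    case True
    then obtain G0 where G0: "G0 \<in> Fpow \<A>" "N G0 = {}" by blast
    \<comment> \<open>Passing from \<open>G\<close> to \<open>G \<union> G0\<close> makes finite errors negligible.\<close>
    have "\<exists>B. B \<in> I \<and> f -` B \<inter> \<Inter>(G \<union> G0) \<notin> J" if "G \<in> Fpow \<A>" for G
      using not_le_restrictE[OF not_le[OF has_FIP_Inter_notin[OF fip Fpow_Un[OF that G0(1)]]] \<open>f \<in> F\<close>]
      by blast
    then obtain b where b: "\<And>G. G \<in> Fpow \<A> \<Longrightarrow> b G \<in> I"
        "\<And>G. G \<in> Fpow \<A> \<Longrightarrow> f -` (b G) \<inter> \<Inter>(G \<union> G0) \<notin> J"
      by metis
    have "infinite (b G - B)" if G: "G \<in> Fpow \<A>" and "f -` B \<inter> \<Inter>G \<in> J" for G B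
    proof
      assume "finite (b G - B)"
      then have "f -` (b G - B) \<inter> \<Inter>G0 \<in> J"
        by (rule vimage_finite_Int_in_ideal[OF J]) (use G0(2) in \<open>auto simp: N_def\<close>)
      with that(2) have "(f -` B \<inter> \<Inter>G) \<union> (f -` (b G - B) \<inter> \<Inter>G0) \<in> J"
        by (rule ideal_onD(1)[OF J])
      moreover have "f -` (b G) \<inter> \<Inter>(G \<union> G0) \<subseteq> (f -` B \<inter> \<Inter>G) \<union> (f -` (b G - B) \<inter> \<Inter>G0)"
        by blast
      ultimately show False using b(2)[OF G] ideal_onD(2)[OF J] by blast
    qed
    with no_B have "\<not> (\<exists>B\<in>I. \<forall>G\<in>Fpow \<A>. finite (b G - B))" by blast
    with b(1) show ?thesis by (intro that[of b]) blast+
  next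
    case False
    \<comment> \<open>Were \<open>N G\<close> finite, it would be in \<open>I\<close>, and its preimage would extend \<open>\<A>\<close>, because
      every \<open>N (G \<union> H)\<close> is a nonempty subset of \<open>N G\<close>.\<close>
    have "infinite (N G)" if G: "G \<in> Fpow \<A>" for G
    proof
      assume fin: "finite (N G)"
      then have "N G \<in> I" by (simp add: ideal_onD(3)[OF I])
      then obtain H where H: "H \<in> Fpow \<A>" "f -` (N G) \<inter> \<Inter>H \<in> J" using no_B by blast
      from False Fpow_Un[OF G H(1)] obtain n where n: "f -` {n} \<inter> \<Inter>(G \<union> H) \<notin> J"
        unfolding N_def by blast
      have "f -` {n} \<inter> \<Inter>(G \<union> H) \<subseteq> f -` {n} \<inter> \<Inter>G" by blast
      with n have "n \<in> N G" using ideal_onD(2)[OF J] unfolding N_def by blast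
      then have "f -` {n} \<inter> \<Inter>(G \<union> H) \<subseteq> f -` (N G) \<inter> \<Inter>H" by blast
      with n H(2) show False using ideal_onD(2)[OF J] by blast
    qed
    then have "\<exists>B. B \<in> I \<and> infinite B \<and> B \<subseteq> N G" if "G \<in> Fpow \<A>" for G
      using \<open>tall I\<close> that unfolding tall_def by blast
    then obtain b where b: "\<And>G. G \<in> Fpow \<A> \<Longrightarrow> b G \<in> I"
        "\<And>G. G \<in> Fpow \<A> \<Longrightarrow> infinite (b G)" "\<And>G. G \<in> Fpow \<A> \<Longrightarrow> b G \<subseteq> N G"
      by metis
    have "infinite (b G - B)" if G: "G \<in> Fpow \<A>" and "f -` B \<inter> \<Inter>G \<in> J" for G B
    proof -
      have "n \<notin> B" if "n \<in> b G" for n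
      proof
        assume "n \<in> B"
        then have "f -` {n} \<inter> \<Inter>G \<subseteq> f -` B \<inter> \<Inter>G" by blast
        with \<open>f -` B \<inter> \<Inter>G \<in> J\<close> have "f -` {n} \<inter> \<Inter>G \<in> J" using ideal_onD(2)[OF J] by blast
        with b(3)[OF G] \<open>n \<in> b G\<close> show False unfolding N_def by blast
      qed
      then have "b G - B = b G" by blast
      with b(2)[OF G] show ?thesis by simp
    qed
    with no_B have "\<not> (\<exists>B\<in>I. \<forall>G\<in>Fpow \<A>. finite (b G - B))" by blast
    with b(1) show ?thesis by (intro that[of b]) blast+
  qed
qed

text \<open>
  Without this, the finite subsets of \<open>\<A>\<close> could outnumber \<open>\<A>\<close>.
\<close>
lemma infinite_if_vimage_not_extends_FIP:
  assumes J: "ideal_on UNIV J"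
    and not_le: "\<And>A. A \<notin> J \<Longrightarrow> \<not> le_restrict F I J A"
    and fip: "has_FIP J \<A>" and "f \<in> F"
    and no_ext: "\<not> (\<exists>B\<in>I. has_FIP J (\<A> \<union> {f -` B}))"
  shows "infinite \<A>"
proof
  assume "finite \<A>"
  \<comment> \<open>The intersection of a finite family is a pseudointersection of it.\<close>
  then have "\<Inter>\<A> \<notin> J" using has_FIP_Inter_notin[OF fip, of \<A>] by (simp add: Fpow_def)
  moreover have "\<Inter>\<A> - A \<in> J" if "A \<in> \<A>" for A
  proof -
    have "\<Inter>\<A> - A = {}" using that by blast
    then show ?thesis using ideal_onD(3)[OF J, of "{}"] by (simp only: subset_UNIV finite.emptyI)
  qed
  ultimately have "pseudointersection J \<A> (\<Inter>\<A>)"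
    by (simp add: pseudointersection_def Defs.positive_def)
  from vimage_extends_FIP_if_pseudointersection[OF J not_le this \<open>f \<in> F\<close>] no_ext
  show False by blast
qed

section \<open>Minima of cardinals and the two inequalities\<close>

lemma Card_order_cards: "r \<in> cards S \<Longrightarrow> Card_order r"
  by (simp add: cards_def)

lemma card_min_cards_ordLeq:
  assumes "\<A> \<in> S"
  shows "card_min (cards S) \<le>o |\<A>|"
proof -
  obtain r where r: "r \<in> cards S" "r =o |\<A>|" using cards_represented[OF assms] by blast
  then have "card_min (cards S) \<le>o r" using card_min_attained(2) Card_order_cards by blast
  then show ?thesis using r(2) ordLeq_ordIso_trans by blast
qed

lemma card_min_cards_succ_ordLeq:
  assumes "r \<in> cards S \<union> {continuum_succ}"
  shows "card_min (cards S \<union> {continuum_succ}) \<le>o r"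
  using card_min_attained(2)[OF _ _ assms] Card_order_cards Card_order_continuum_succ by blast

text \<open>
  The minimum is either the default value \<open>c\<^sup>+\<close> or the cardinality of a member of \<open>S\<close>.
\<close>
lemma card_min_cards_succ_cases:
  obtains (succ) "card_min (cards S \<union> {continuum_succ}) = continuum_succ"
  | (family) \<A> where "\<A> \<in> S" "card_min (cards S \<union> {continuum_succ}) =o |\<A>|"
      "card_min (cards S \<union> {continuum_succ}) \<in> cards S"
proof -
  have "card_min (cards S \<union> {continuum_succ}) \<in> cards S \<union> {continuum_succ}"
    using card_min_attained(1)[of "cards S \<union> {continuum_succ}"]
      Card_order_cards Card_order_continuum_succ by blast
  then show ?thesis using that by (auto simp: cards_def)
qed

lemma card_min_cards_succ_mono:
  assumes "S \<subseteq> T"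
  shows "card_min (cards T \<union> {continuum_succ}) \<le>o card_min (cards S \<union> {continuum_succ})"
proof (rule card_min_cards_succ_cases[of S])
  have "cards S \<subseteq> cards T" using assms by (auto simp: cards_def)
  then show "card_min (cards T \<union> {continuum_succ}) \<le>o card_min (cards S \<union> {continuum_succ})"
    if "card_min (cards S \<union> {continuum_succ}) \<in> cards S"
    using that by (intro card_min_cards_succ_ordLeq) blast
  show "card_min (cards T \<union> {continuum_succ}) \<le>o card_min (cards S \<union> {continuum_succ})"
    if "card_min (cards S \<union> {continuum_succ}) = continuum_succ"
    unfolding that by (rule card_min_cards_succ_ordLeq) simp
qed

lemma add_star_ordLeq:
  assumes "\<B> \<subseteq> I" "\<not> (\<exists>B\<in>I. \<forall>A\<in>\<B>. finite (A - B))"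
  shows "add_star I \<le>o |\<B>|"
  unfolding add_star_def by (rule card_min_cards_ordLeq) (use assms in blast)

lemma add_star_ordLeq_continuum_succ:
  assumes "ideal_on UNIV I" "tall I"
  shows "add_star I \<le>o continuum_succ"
proof -
  obtain \<B> where "\<B> \<subseteq> I" "\<not> (\<exists>B\<in>I. \<forall>A\<in>\<B>. finite (A - B))"
    using add_star_well_defined[OF assms] unfolding cards_def by blast
  then have "add_star I \<le>o |\<B>|" by (rule add_star_ordLeq)
  also have "|\<B>| \<le>o |UNIV :: nat set set|" by (rule card_of_mono1) simp
  also have "|UNIV :: nat set set| \<le>o continuum_succ"
    unfolding continuum_succ_def by (rule cardSuc_ordLeq[OF card_of_Card_order])
  finally show ?thesis .
qed

theorem theorem4p1:
  fixes F :: "(nat \<Rightarrow> nat) set" and I J :: "nat set set"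
  assumes "ideal_on UNIV I"
    and "ideal_on UNIV J"
    and "tall I"
    and "\<And>A. A \<notin> J \<Longrightarrow> \<not> le_restrict F I J A"
  shows "p_inv J \<le>o fip_inv I J F \<and> add_star I \<le>o fip_inv I J F"
proof
  let ?S = "{\<A>. has_FIP J \<A> \<and> \<not> (\<forall>f\<in>F. \<exists>B\<in>I. has_FIP J (\<A> \<union> {f -` B}))}"
  show "p_inv J \<le>o fip_inv I J F"
    unfolding p_inv_def fip_inv_def
  proof (rule card_min_cards_succ_mono)
    show "?S \<subseteq> {\<A>. has_FIP J \<A> \<and> \<not> (\<exists>B. pseudointersection J \<A> B)}"
      using vimage_extends_FIP_if_pseudointersection[OF assms(2,4)] by blast
  qed
  show "add_star I \<le>o fip_inv I J F"
    unfolding fip_inv_def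
  proof (rule card_min_cards_succ_cases[of ?S])
    assume "card_min (cards ?S \<union> {continuum_succ}) = continuum_succ"
    then show "add_star I \<le>o card_min (cards ?S \<union> {continuum_succ})"
      using add_star_ordLeq_continuum_succ[OF assms(1,3)] by simp
  next
    fix \<A> assume "\<A> \<in> ?S" and eq: "card_min (cards ?S \<union> {continuum_succ}) =o |\<A>|"
    then obtain f where f: "has_FIP J \<A>" "f \<in> F" "\<not> (\<exists>B\<in>I. has_FIP J (\<A> \<union> {f -` B}))"
      by blast
    obtain b where b: "b ` Fpow \<A> \<subseteq> I" "\<not> (\<exists>B\<in>I. \<forall>G\<in>Fpow \<A>. finite (b G - B))"
      using unbounded_family_of_finite_subsets[OF assms f] by blast
    then have "add_star I \<le>o |b ` Fpow \<A>|" by (intro add_star_ordLeq) auto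
    also have "|b ` Fpow \<A>| \<le>o |Fpow \<A>|" by (rule card_of_image)
    also have "|Fpow \<A>| =o |\<A>|"
      by (rule card_of_Fpow_infinite[OF infinite_if_vimage_not_extends_FIP[OF assms(2,4) f]])
    also have "|\<A>| =o card_min (cards ?S \<union> {continuum_succ})"
      using eq by (rule ordIso_symmetric)
    finally show "add_star I \<le>o card_min (cards ?S \<union> {continuum_succ})" .
  qed
qed

end
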